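(* Let $(Q,\cdot)$ be a right Bol loop and let $(Q,\ast)$ be its corresponding middle Bol loop. Let $A\le AUT(Q,\cdot)$, let $(H,\odot)$ be the $A$-holomorph of $(Q,\cdot)$ and let $(H',\circledast)$ be the $A$-holomorph of $(Q,\ast)$. Then $(H,\odot)=(H',\circledast)$ if and only if $(Q,\cdot)$ is commutative.
   Context: Maps are written on the right of their arguments and composed from left to right. A right Bol loop is a loop satisfying $((x\cdot y)\cdot z)\cdot y=x\cdot((y\cdot z)\cdot y)$ for all $x,y,z$. A middle Bol loop is a loop satisfying $x((yz)\backslash x)=(x/z)(y\backslash x)$ for all $x,y,z$, where $x\backslash y$ is the unique $u$ with $xu=y$ and $x/y$ is the unique $u$ with $uy=x$. The middle Bol loop corresponding to a right Bol loop $(Q,\cdot)$ is $(Q,\ast)$ with $x\ast y=(y\cdot(x\cdot y^{-1}))\cdot y$, where $y^{-1}$ is the (two-sided) inverse of $y$ in $(Q,\cdot)$. It is known that $AUT(Q,\cdot)=AUT(Q,\ast)$. For a loop $(Q,\cdot)$ and a subgroup $A\le AUT(Q,\cdot)$ of its automorphism group, the $A$-holomorph is the loop on $A\times Q$ with operation $(\alpha,x)\odot(\beta,y)=(\alpha\beta,\,x\beta\cdot y)$; similarly the $A$-holomorph of $(Q,\ast)$ has operation $(\alpha,x)\circledast(\beta,y)=(\alpha\beta,\,x\beta\ast y)$. Equality of holomorphs means equality of underlying sets and of operations. *)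

theory Defs
  imports "HOL-Algebra.Bij"
begin

text \<open>
  A loop is presented by the library's \<^type>\<open>monoid_ext\<close> record (carrier, product, neutral
  element); associativity is not assumed. The divisions are given by unique solvability.
\<close>

locale loop =
  fixes Q (structure)
  assumes m_closed: "\<lbrakk>x \<in> carrier Q; y \<in> carrier Q\<rbrakk> \<Longrightarrow> x \<otimes> y \<in> carrier Q"
    and one_closed: "\<one> \<in> carrier Q"
    and l_one: "x \<in> carrier Q \<Longrightarrow> \<one> \<otimes> x = x"
    and r_one: "x \<in> carrier Q \<Longrightarrow> x \<otimes> \<one> = x"
    and ldiv_ex1: "\<lbrakk>x \<in> carrier Q; y \<in> carrier Q\<rbrakk> \<Longrightarrow> \<exists>!u. u \<in> carrier Q \<and> x \<otimes> u = y"
    and rdiv_ex1: "\<lbrakk>x \<in> carrier Q; y \<in> carrier Q\<rbrakk> \<Longrightarrow> \<exists>!u. u \<in> carrier Q \<and> u \<otimes> y = x"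

locale right_bol_loop = loop +
  assumes right_bol:
    "\<lbrakk>x \<in> carrier Q; y \<in> carrier Q; z \<in> carrier Q\<rbrakk>
      \<Longrightarrow> ((x \<otimes> y) \<otimes> z) \<otimes> y = x \<otimes> ((y \<otimes> z) \<otimes> y)"

definition commutative :: "('a, 'b) monoid_scheme \<Rightarrow> bool" where
  "commutative Q \<longleftrightarrow> (\<forall>x\<in>carrier Q. \<forall>y\<in>carrier Q. x \<otimes>\<^bsub>Q\<^esub> y = y \<otimes>\<^bsub>Q\<^esub> x)"

text \<open>
  The middle Bol loop corresponding to a right Bol loop. Here \<^const>\<open>m_inv\<close> is by definition
  the two-sided inverse, which exists and is unique in every right Bol loop.
\<close>

definition middle_bol :: "('a, 'b) monoid_scheme \<Rightarrow> 'a monoid" where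
  "middle_bol Q =
     \<lparr>carrier = carrier Q,
      mult = (\<lambda>x y. (y \<otimes>\<^bsub>Q\<^esub> (x \<otimes>\<^bsub>Q\<^esub> inv\<^bsub>Q\<^esub> y)) \<otimes>\<^bsub>Q\<^esub> y),
      one = \<one>\<^bsub>Q\<^esub>\<rparr>"

text \<open>
  The holomorph uses right actions: \<open>x\<beta>\<close> is \<open>\<beta> x\<close>, and the product \<open>\<alpha>\<beta>\<close> (first \<open>\<alpha>\<close>, then \<open>\<beta>\<close>)
  is \<open>compose (carrier Q) \<beta> \<alpha>\<close>, the product of \<^const>\<open>AutoGroup\<close> in reverse order. A subset of
  \<^term>\<open>auto Q\<close> is a subgroup for one order of composition iff it is one for the other.
\<close>

definition holomorph ::
  "('a \<Rightarrow> 'a) set \<Rightarrow> ('a, 'b) monoid_scheme \<Rightarrow> (('a \<Rightarrow> 'a) \<times> 'a) monoid" where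
  "holomorph A Q =
     \<lparr>carrier = A \<times> carrier Q,
      mult = (\<lambda>(\<alpha>, x) (\<beta>, y). (compose (carrier Q) \<beta> \<alpha>, \<beta> x \<otimes>\<^bsub>Q\<^esub> y)),
      one = (\<lambda>x\<in>carrier Q. x, \<one>\<^bsub>Q\<^esub>)\<rparr>"

text \<open>
  Products are total functions in HOL, so equality of operations is required on the carrier only.
\<close>

definition same_loop :: "('a, 'b) monoid_scheme \<Rightarrow> ('a, 'c) monoid_scheme \<Rightarrow> bool" where
  "same_loop G H \<longleftrightarrow>
     carrier G = carrier H \<and>
     (\<forall>x\<in>carrier G. \<forall>y\<in>carrier G. x \<otimes>\<^bsub>G\<^esub> y = x \<otimes>\<^bsub>H\<^esub> y)"

end

theory Submission imports Defs begin

text \<open>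
  Evaluating both products at the identity automorphism reduces the equality of the holomorphs to
  \<open>x \<cdot> y = (y \<cdot> (x \<cdot> y\<^sup>-\<^sup>1)) \<cdot> y\<close> for all \<open>x, y\<close>. Cancelling \<open>y\<close> and putting \<open>x = z \<cdot> y\<close>, the right
  inverse property \<open>(z \<cdot> y) \<cdot> y\<^sup>-\<^sup>1 = z\<close> turns this identity into \<open>z \<cdot> y = y \<cdot> z\<close>.
\<close>

context loop
begin

lemma r_cancel:
  assumes "x \<in> carrier Q" "x' \<in> carrier Q" "y \<in> carrier Q" "x \<otimes> y = x' \<otimes> y"
  shows "x = x'"
  using assms rdiv_ex1[of "x' \<otimes> y" y] m_closed by blast

end

context right_bol_loop
begin

text \<open>The right Bol identity collapses to
  \<open>((x \<otimes> y) \<otimes> z) \<otimes> y = x \<otimes> y\<close> when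
  \<open>y \<otimes> z = \<one>\<close>, and the last factor \<open>y\<close> cancels. An arbitrary
  right inverse \<open>z\<close> is used because \<open>inv y\<close> is only shown to be well
  defined in \<open>inv_props\<close>.\<close>

lemma right_inverse_cancel:
  assumes "x \<in> carrier Q" "y \<in> carrier Q" "z \<in> carrier Q" "y \<otimes> z = \<one>"
  shows "(x \<otimes> y) \<otimes> z = x"
proof -
  have "((x \<otimes> y) \<otimes> z) \<otimes> y = x \<otimes> y"
    using right_bol[of x y z] assms by (simp add: l_one)
  then show ?thesis
    using assms by (blast intro: r_cancel m_closed)
qed

text \<open>If \<open>u\<close> is the left inverse of \<open>y\<close>, then
  \<open>(u \<otimes> y) \<otimes> z\<close> equals \<open>u\<close> by the previous lemma and
  \<open>z\<close> by \<open>u \<otimes> y = \<one>\<close>, so \<open>u = z\<close>.\<close>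

lemma right_inverse_is_left_inverse:
  assumes "y \<in> carrier Q" "z \<in> carrier Q" "y \<otimes> z = \<one>"
  shows "z \<otimes> y = \<one>"
proof -
  obtain u where u: "u \<in> carrier Q" "u \<otimes> y = \<one>"
    using rdiv_ex1[OF one_closed assms(1)] by blast
  then show ?thesis
    using right_inverse_cancel[of u y z] assms by (simp add: l_one)
qed

lemma inv_props:
  assumes "y \<in> carrier Q"
  shows inv_closed: "inv y \<in> carrier Q"
    and r_inv: "y \<otimes> inv y = \<one>"
    and l_inv: "inv y \<otimes> y = \<one>"
proof -
  \<comment> \<open>\<open>m_inv\<close> is a definite description, so unique existence must come
    first; uniqueness is that of the right inverse.\<close>
  have "\<exists>!z. z \<in> carrier Q \<and> y \<otimes> z = \<one> \<and> z \<otimes> y = \<one>"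
    using ldiv_ex1[OF assms one_closed] right_inverse_is_left_inverse[OF assms] by blast
  from theI'[OF this] show "inv y \<in> carrier Q" "y \<otimes> inv y = \<one>" "inv y \<otimes> y = \<one>"
    by (simp_all add: m_inv_def)
qed

text \<open>The second equation is \<open>right_inverse_cancel\<close> with \<open>inv y\<close> and
  \<open>y\<close> in the roles of \<open>y\<close> and \<open>z\<close>, which \<open>l_inv\<close>
  permits.\<close>

lemma right_inverse_property:
  assumes "x \<in> carrier Q" "y \<in> carrier Q"
  shows "(x \<otimes> y) \<otimes> inv y = x" and "(x \<otimes> inv y) \<otimes> y = x"
  using assms by (simp_all add: right_inverse_cancel inv_props)

lemma same_loop_middle_bol_iff:
  "same_loop Q (middle_bol Q) \<longleftrightarrow> commutative Q"
proof -
  have unfolded: "same_loop Q (middle_bol Q) \<longleftrightarrow>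
      (\<forall>x\<in>carrier Q. \<forall>y\<in>carrier Q. x \<otimes> y = (y \<otimes> (x \<otimes> inv y)) \<otimes> y)"
    unfolding same_loop_def middle_bol_def monoid.select_convs partial_object.select_convs by blast
  show ?thesis
  proof
    assume same: "same_loop Q (middle_bol Q)"
    show "commutative Q"
      unfolding commutative_def
    proof (intro ballI)
      fix z y assume z: "z \<in> carrier Q" and y: "y \<in> carrier Q"
      have "(z \<otimes> y) \<otimes> y = (y \<otimes> ((z \<otimes> y) \<otimes> inv y)) \<otimes> y"
        using same y m_closed[OF z y] unfolding unfolded by blast
      then have "(z \<otimes> y) \<otimes> y = (y \<otimes> z) \<otimes> y"
        using y z by (simp add: right_inverse_property)
      then show "z \<otimes> y = y \<otimes> z"
        using y z by (blast intro: r_cancel m_closed)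
    qed
  next
    assume comm: "commutative Q"
    show "same_loop Q (middle_bol Q)"
      unfolding unfolded
    proof (intro ballI)
      fix x y assume x: "x \<in> carrier Q" and y: "y \<in> carrier Q"
      \<comment> \<open>Commuting these two factors makes the inner product collapse to
        \<open>x\<close>.\<close>
      have "y \<otimes> (x \<otimes> inv y) = (x \<otimes> inv y) \<otimes> y"
        using comm y m_closed[OF x inv_closed[OF y]] unfolding commutative_def by blast
      then show "x \<otimes> y = (y \<otimes> (x \<otimes> inv y)) \<otimes> y"
        using x y by (simp add: right_inverse_property)
    qed
  qed
qed

end

lemma same_loop_holomorph_iff:
  assumes "subgroup A (AutoGroup Q)" and "carrier R = carrier Q"
  shows "same_loop (holomorph A Q) (holomorph A R) \<longleftrightarrow> same_loop Q R"
proof -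
  have id: "(\<lambda>x\<in>carrier Q. x) \<in> A"
    using subgroup.one_closed[OF assms(1)] by (simp add: AutoGroup_def BijGroup_def)
  have closed: "\<beta> x \<in> carrier Q" if "\<beta> \<in> A" "x \<in> carrier Q" for \<beta> x
    using that subgroup.subset[OF assms(1)] by (auto simp: AutoGroup_def auto_def hom_def)
  \<comment> \<open>The first components of the two products agree because \<open>Q\<close> and
    \<open>R\<close> share their carrier, so only the second components are compared.\<close>
  have "same_loop (holomorph A Q) (holomorph A R) \<longleftrightarrow>
      (\<forall>\<alpha>\<in>A. \<forall>x\<in>carrier Q. \<forall>\<beta>\<in>A. \<forall>y\<in>carrier Q. \<beta> x \<otimes>\<^bsub>Q\<^esub> y = \<beta> x \<otimes>\<^bsub>R\<^esub> y)"
    by (simp add: same_loop_def holomorph_def assms(2) Ball_def) blast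
  also have "\<dots> \<longleftrightarrow> (\<forall>x\<in>carrier Q. \<forall>y\<in>carrier Q. x \<otimes>\<^bsub>Q\<^esub> y = x \<otimes>\<^bsub>R\<^esub> y)"
    (is "?hol \<longleftrightarrow> ?base")
  proof
    assume hol: ?hol
    show ?base
    proof (intro ballI)
      fix x y assume x: "x \<in> carrier Q" and y: "y \<in> carrier Q"
      show "x \<otimes>\<^bsub>Q\<^esub> y = x \<otimes>\<^bsub>R\<^esub> y"
        using hol[rule_format, OF id x id y] by (simp only: restrict_apply' x)
    qed
  next
    assume ?base
    then show ?hol
      \<comment> \<open>Each \<open>\<beta>\<close> maps the carrier into itself, so
        \<open>?base\<close> applies to \<open>\<beta> x\<close> and \<open>y\<close>.\<close>
      using closed by blast
  qed
  also have "\<dots> \<longleftrightarrow> same_loop Q R"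
    by (simp add: same_loop_def assms(2))
  finally show ?thesis .
qed

theorem theorem2p3:
  fixes Q :: "('a, 'b) monoid_scheme" and A :: "('a \<Rightarrow> 'a) set"
  assumes "right_bol_loop Q"
    and "subgroup A (AutoGroup Q)"
  shows "same_loop (holomorph A Q) (holomorph A (middle_bol Q)) \<longleftrightarrow> commutative Q"
proof -
  have "carrier (middle_bol Q) = carrier Q"
    by (simp add: middle_bol_def)
  then show ?thesis
    using same_loop_holomorph_iff[OF assms(2)]
      right_bol_loop.same_loop_middle_bol_iff[OF assms(1)] by metis
qed

end
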